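(* Let $\mathbf P=(P,\leq,{}',0,1)$ be a bounded poset of finite height with complementation satisfying $x''=x$ for all $x\in P$, and define mappings $\odot,\rightarrow\colon P^2\rightarrow 2^P\setminus\{\emptyset\}$ by $$x\odot y:=\operatorname{Min}U(x,y')\wedge y,\qquad x\rightarrow y:=x'\vee\operatorname{Max}L(x,y)$$ whenever defined ($x,y\in P$). Then $0'=1$ and $1'=0$, and the following hold: (a) Assume $\mathbf P$ to be weakly orthomodular. Then $\odot$ is well-defined (i.e. $x\odot y$ is defined for all $x,y\in P$). Assume $\rightarrow$ to be well-defined, too. Then $\mathbb R(\mathbf P):=(P,\leq,\odot,\rightarrow,0,1)$ satisfies all the conditions of an idempotent operator residuated structure satisfying the double negation law, and satisfies $x\vee(x\rightarrow 0)=1$ and $x\rightarrow 0=x'$ for all $x\in P$, except that the operator left adjointness condition is replaced by: for all $x,y,z\in P$, $x\odot y\sqsubseteq z$ implies $x\sqsubseteq y\rightarrow z$. (b) Assume $\mathbf P$ to be dually weakly orthomodular. Then $\rightarrow$ is well-defined. Assume $\odot$ to be well-defined, too. Then $\mathbb R(\mathbf P):=(P,\leq,\odot,\rightarrow,0,1)$ satisfies all the conditions of an idempotent divisible operator residuated structure satisfying the double negation law, and satisfies $x\rightarrow 0=x'$ for all $x\in P$, except that the operator left adjointness condition is replaced by: for all $x,y,z\in P$, $x\sqsubseteq y\rightarrow z$ implies $x\odot y\sqsubseteq z$.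
   Context: A complementation on a bounded poset is a unary operation $'$ with $x\vee x'=1$ and $x\wedge x'=0$ for all $x$ (not assumed antitone). A poset is of finite height if it contains no infinite chain. A weakly orthomodular poset is a bounded poset $(P,\leq,{}',0,1)$ with complementation such that $x\leq y$ implies that $x\vee(y\wedge x')$ is defined and equals $y$. A dually weakly orthomodular poset is a bounded poset $(P,\leq,{}',0,1)$ with complementation such that $x\leq y$ implies that $y\wedge(x\vee y')$ is defined and equals $x$. Set notation in a poset $(P,\le)$: for $A,B\subseteq P$, $A\leq B$ means $x\leq y$ for all $x\in A$, $y\in B$; $L(x,y)$ and $U(x,y)$ are the sets of common lower and common upper bounds of $x,y$; $\operatorname{Min}A$ and $\operatorname{Max}A$ are the sets of minimal and maximal elements of $A$. Lattice operations on sets are elementwise: $A\wedge y=\{a\wedge y\mid a\in A\}$, $x\vee A=\{x\vee a\mid a\in A\}$, etc.; such an expression is defined if all the meets or joins involved exist. Elements $x$ are identified with singletons $\{x\}$. For non-empty $A,B\subseteq P$: $A\sqsubseteq B$ iff there are $a\in A$ and $b\in B$ with $a\leq b$. For a mapping $\otimes\colon P^2\to 2^P$, $A\subseteq P$ and $y\in P$ put $A\otimes y:=\bigcup_{x\in A}(x\otimes y)$. An operator residuated structure is a six-tuple $(P,\leq,\odot,\rightarrow,0,1)$ such that for all $x,y,z\in P$: (i) $(P,\leq,0,1)$ is a bounded poset; (ii) $\odot$ and $\rightarrow$ are mappings from $P^2$ to $2^P\setminus\{\emptyset\}$; (iii) (operator left adjointness) $x\odot y\sqsubseteq z$ if and only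 if $x\sqsubseteq y\rightarrow z$; (iv) $x\odot 1=1\odot x=x$; (v) $y\rightarrow 0\leq x$ implies $x\odot y=x\wedge y$ (in particular the meet exists); (vi) $y\leq x$ implies $x\rightarrow y=(x\rightarrow 0)\vee y$ (in particular the joins exist). It is idempotent if $x\odot x=x$ for all $x$; divisible if $(x\rightarrow y)\odot x=\operatorname{Max}L(x,y)$ for all $x,y$; it satisfies the double negation law if $(x\rightarrow 0)\rightarrow 0=x$ for all $x$. *)

theory Defs
  imports "HOL-Library.Lub_Glb"
begin

text \<open>
  A bounded poset is a type of sort \<open>{order_bot, order_top}\<close>, with \<open>0 = bot\<close> and \<open>1 = top\<close>;
  the one-element poset is allowed. Joins and meets are partial: \<open>isLub UNIV {x, y} z\<close> says that
  \<open>x \<squnion> y\<close> exists and equals \<open>z\<close>, and dually for \<open>isGlb\<close>.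
\<close>

definition complementation :: "('a::{order_bot,order_top} \<Rightarrow> 'a) \<Rightarrow> bool" where
  "complementation c \<longleftrightarrow> (\<forall>x. isLub UNIV {x, c x} top \<and> isGlb UNIV {x, c x} bot)"

definition finite_height :: "'a::order set \<Rightarrow> bool" where
  "finite_height A \<longleftrightarrow> \<not> (\<exists>C\<subseteq>A. Complete_Partial_Order.chain (\<le>) C \<and> infinite C)"

definition weakly_orthomodular :: "('a::{order_bot,order_top} \<Rightarrow> 'a) \<Rightarrow> bool" where
  "weakly_orthomodular c \<longleftrightarrow> complementation c \<and>
     (\<forall>x y. x \<le> y \<longrightarrow> (\<exists>m. isGlb UNIV {y, c x} m \<and> isLub UNIV {x, m} y))"

definition dually_weakly_orthomodular :: "('a::{order_bot,order_top} \<Rightarrow> 'a) \<Rightarrow> bool" where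
  "dually_weakly_orthomodular c \<longleftrightarrow> complementation c \<and>
     (\<forall>x y. x \<le> y \<longrightarrow> (\<exists>j. isLub UNIV {x, c y} j \<and> isGlb UNIV {y, j} x))"

definition lower_cone :: "'a::order \<Rightarrow> 'a \<Rightarrow> 'a set" where
  "lower_cone x y = {z. z \<le> x \<and> z \<le> y}"

definition upper_cone :: "'a::order \<Rightarrow> 'a \<Rightarrow> 'a set" where
  "upper_cone x y = {z. x \<le> z \<and> y \<le> z}"

definition minimals :: "'a::order set \<Rightarrow> 'a set" where
  "minimals A = {a \<in> A. \<forall>b\<in>A. b \<le> a \<longrightarrow> b = a}"

definition maximals :: "'a::order set \<Rightarrow> 'a set" where
  "maximals A = {a \<in> A. \<forall>b\<in>A. a \<le> b \<longrightarrow> b = a}"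

text \<open>
  Elementwise meets and joins of sets; an element is passed as a singleton. \<open>set_meet A B\<close> collects
  those meets \<open>a \<sqinter> b\<close> that exist, so it is the intended value only when \<open>set_meet_defined A B\<close>
  holds; likewise for joins.
\<close>

definition set_meet_defined :: "'a::order set \<Rightarrow> 'a set \<Rightarrow> bool" where
  "set_meet_defined A B \<longleftrightarrow> (\<forall>a\<in>A. \<forall>b\<in>B. \<exists>z. isGlb UNIV {a, b} z)"

definition set_meet :: "'a::order set \<Rightarrow> 'a set \<Rightarrow> 'a set" where
  "set_meet A B = {z. \<exists>a\<in>A. \<exists>b\<in>B. isGlb UNIV {a, b} z}"

definition set_join_defined :: "'a::order set \<Rightarrow> 'a set \<Rightarrow> bool" where
  "set_join_defined A B \<longleftrightarrow> (\<forall>a\<in>A. \<forall>b\<in>B. \<exists>z. isLub UNIV {a, b} z)"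

definition set_join :: "'a::order set \<Rightarrow> 'a set \<Rightarrow> 'a set" where
  "set_join A B = {z. \<exists>a\<in>A. \<exists>b\<in>B. isLub UNIV {a, b} z}"

definition sqle :: "'a::order set \<Rightarrow> 'a set \<Rightarrow> bool" where
  "sqle A B \<longleftrightarrow> (\<exists>a\<in>A. \<exists>b\<in>B. a \<le> b)"

definition set_op :: "('a \<Rightarrow> 'a \<Rightarrow> 'a set) \<Rightarrow> 'a set \<Rightarrow> 'a \<Rightarrow> 'a set" where
  "set_op f A y = (\<Union>x\<in>A. f x y)"

text \<open>All axioms of an operator residuated structure except operator left adjointness.\<close>

locale operator_residuated_base =
  fixes dot imp :: "'a::{order_bot,order_top} \<Rightarrow> 'a \<Rightarrow> 'a set"
  assumes dot_nonempty: "dot x y \<noteq> {}"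
    and imp_nonempty: "imp x y \<noteq> {}"
    and dot_top: "dot x top = {x}"
    and top_dot: "dot top x = {x}"
    and dot_eq_meet: "(\<forall>u\<in>imp y bot. u \<le> x) \<Longrightarrow>
      set_meet_defined {x} {y} \<and> dot x y = set_meet {x} {y}"
    and imp_eq_join: "y \<le> x \<Longrightarrow>
      set_join_defined (imp x bot) {y} \<and> imp x y = set_join (imp x bot) {y}"

locale operator_residuated = operator_residuated_base +
  assumes left_adjointness: "sqle (dot x y) {z} \<longleftrightarrow> sqle {x} (imp y z)"

definition idempotent_dot :: "('a \<Rightarrow> 'a \<Rightarrow> 'a set) \<Rightarrow> bool" where
  "idempotent_dot dot \<longleftrightarrow> (\<forall>x. dot x x = {x})"

definition divisible :: "('a::order \<Rightarrow> 'a \<Rightarrow> 'a set) \<Rightarrow> ('a \<Rightarrow> 'a \<Rightarrow> 'a set) \<Rightarrow> bool" where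
  "divisible dot imp \<longleftrightarrow> (\<forall>x y. set_op dot (imp x y) x = maximals (lower_cone x y))"

definition double_negation :: "('a::order_bot \<Rightarrow> 'a \<Rightarrow> 'a set) \<Rightarrow> bool" where
  "double_negation imp \<longleftrightarrow> (\<forall>x. set_op imp (imp x bot) bot = {x})"

definition odot_defined :: "('a::order \<Rightarrow> 'a) \<Rightarrow> 'a \<Rightarrow> 'a \<Rightarrow> bool" where
  "odot_defined c x y \<longleftrightarrow> set_meet_defined (minimals (upper_cone x (c y))) {y}"

definition odot :: "('a::order \<Rightarrow> 'a) \<Rightarrow> 'a \<Rightarrow> 'a \<Rightarrow> 'a set" where
  "odot c x y = set_meet (minimals (upper_cone x (c y))) {y}"

definition arrow_defined :: "('a::order \<Rightarrow> 'a) \<Rightarrow> 'a \<Rightarrow> 'a \<Rightarrow> bool" where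
  "arrow_defined c x y \<longleftrightarrow> set_join_defined {c x} (maximals (lower_cone x y))"

definition arrow :: "('a::order \<Rightarrow> 'a) \<Rightarrow> 'a \<Rightarrow> 'a \<Rightarrow> 'a set" where
  "arrow c x y = set_join {c x} (maximals (lower_cone x y))"

end

theory Submission
  imports Defs
begin

text \<open>
  If \<open>a\<close> is above \<open>y'\<close>, weak orthomodularity supplies the meet \<open>a \<sqinter> y\<close> and recovers
  \<open>a = y' \<squnion> (a \<sqinter> y)\<close>. Hence if \<open>a\<close> is minimal in \<open>U(x, y')\<close> with \<open>a \<sqinter> y \<le> z\<close>, any maximal \<open>b\<close> of
  \<open>L(y, z)\<close> above \<open>a \<sqinter> y\<close>, which exists by finite height, satisfies \<open>x \<le> a \<le> y' \<squnion> b\<close>. Dually, if \<open>b \<le> y\<close>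
  then \<open>b = y \<sqinter> (b \<squnion> y')\<close>, which gives the converse implication and also divisibility.
\<close>

section \<open>Joins and meets of pairs in a poset\<close>

lemma isLub_pair_iff:
  fixes a b z :: "'a::order"
  shows "isLub UNIV {a, b} z \<longleftrightarrow> a \<le> z \<and> b \<le> z \<and> (\<forall>w. a \<le> w \<longrightarrow> b \<le> w \<longrightarrow> z \<le> w)"
  by (auto simp: isLub_def leastP_def isUb_def setle_def setge_def)

lemma isGlb_pair_iff:
  fixes a b z :: "'a::order"
  shows "isGlb UNIV {a, b} z \<longleftrightarrow> z \<le> a \<and> z \<le> b \<and> (\<forall>w. w \<le> a \<longrightarrow> w \<le> b \<longrightarrow> w \<le> z)"
  by (auto simp: isGlb_def greatestP_def isLb_def setle_def setge_def)

lemma isLub_pair_of_le: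
  fixes a b z :: "'a::order"
  assumes "a \<le> b"
  shows "isLub UNIV {a, b} z \<longleftrightarrow> z = b" "isLub UNIV {b, a} z \<longleftrightarrow> z = b"
  using assms by (auto simp: isLub_pair_iff intro: order.antisym)

lemma isGlb_pair_of_le:
  fixes a b z :: "'a::order"
  assumes "a \<le> b"
  shows "isGlb UNIV {a, b} z \<longleftrightarrow> z = a" "isGlb UNIV {b, a} z \<longleftrightarrow> z = a"
  using assms by (auto simp: isGlb_pair_iff intro: order.antisym)

lemma isLub_pair_unique:
  fixes a b u v :: "'a::order"
  shows "isLub UNIV {a, b} u \<Longrightarrow> isLub UNIV {a, b} v \<Longrightarrow> u = v"
  by (simp add: isLub_pair_iff order.antisym)

lemma isGlb_pair_unique:
  fixes a b u v :: "'a::order"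
  shows "isGlb UNIV {a, b} u \<Longrightarrow> isGlb UNIV {a, b} v \<Longrightarrow> u = v"
  by (simp add: isGlb_pair_iff order.antisym)

text \<open>An existing join is the least element of the upper cone, hence its only minimal element.
  This makes the first operand of \<open>odot\<close> a singleton.\<close>

lemma minimals_upper_cone_of_isLub:
  "isLub UNIV {x, y} u \<Longrightarrow> minimals (upper_cone x y) = {u}"
  by (auto simp: isLub_pair_iff minimals_def upper_cone_def intro: order.antisym)

lemma maximals_lower_cone_of_isGlb:
  "isGlb UNIV {x, y} u \<Longrightarrow> maximals (lower_cone x y) = {u}"
  by (auto simp: isGlb_pair_iff maximals_def lower_cone_def intro: order.antisym)

section \<open>Finite height and extremal elements\<close>

text \<open>By transitivity any two terms of an infinite descending \<open>R\<close>-sequence are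
  \<open>R\<close>-related; irreflexivity then makes the sequence injective, and comparability makes
  its range an infinite chain. The relation is left general so that both \<open><\<close> and
  \<open>>\<close> are covered.\<close>

lemma finite_height_wfP:
  fixes R :: "'a::order \<Rightarrow> 'a \<Rightarrow> bool"
  assumes fh: "finite_height (UNIV :: 'a set)"
    and "transp R" "irreflp R" and comparable: "\<And>x y. R x y \<Longrightarrow> x \<le> y \<or> y \<le> x"
  shows "wfP R"
proof (rule ccontr)
  assume "\<not> wfP R"
  then obtain f :: "nat \<Rightarrow> 'a" where f: "\<And>i. R (f (Suc i)) (f i)"
    unfolding wfp_def wf_iff_no_infinite_down_chain by blast
  have desc: "R (f j) (f i)" if "i < j" for i j
    using that
  proof (induction j)
    case (Suc j)
    then show ?case
      using f[of j] \<open>transp R\<close> by (cases "i = j") (auto elim: transpE)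
  qed simp
  have "inj f"
    using desc \<open>irreflp R\<close> by (metis injI irreflpD linorder_neqE_nat)
  then have "infinite (range f)"
    using finite_imageD infinite_UNIV_nat by blast
  moreover have "Complete_Partial_Order.chain (\<le>) (range f)"
    unfolding chain_def by clarify (metis comparable desc linorder_neqE_nat order.refl)
  ultimately show False
    using fh by (auto simp: finite_height_def)
qed

lemma finite_height_minimal_below:
  fixes x :: "'a::order"
  assumes "finite_height (UNIV :: 'a set)" and "x \<in> A"
  obtains a where "a \<in> minimals A" "a \<le> x"
proof -
  have "wfP ((<) :: 'a \<Rightarrow> 'a \<Rightarrow> bool)"
    using assms(1) by (rule finite_height_wfP) (auto simp: irreflp_def)
  moreover have "x \<in> {z \<in> A. z \<le> x}" using assms(2) by simp
  ultimately obtain a where "a \<in> {z \<in> A. z \<le> x}" "\<And>b. b < a \<Longrightarrow> b \<notin> {z \<in> A. z \<le> x}"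
    unfolding wfp_def by (rule wfE_min) blast
  \<comment> \<open>Anything strictly below \<open>a\<close> is also below \<open>x\<close>, so
    minimality in the truncated set carries over to \<open>A\<close>.\<close>
  then have "a \<in> minimals A" "a \<le> x"
    by (auto simp: minimals_def order.order_iff_strict dest: order.strict_trans)
  then show thesis by (rule that)
qed

lemma finite_height_maximal_above:
  fixes x :: "'a::order"
  assumes "finite_height (UNIV :: 'a set)" and "x \<in> A"
  obtains a where "a \<in> maximals A" "x \<le> a"
proof -
  have "wfP ((>) :: 'a \<Rightarrow> 'a \<Rightarrow> bool)"
    using assms(1) by (rule finite_height_wfP) (auto simp: irreflp_def)
  moreover have "x \<in> {z \<in> A. x \<le> z}" using assms(2) by simp
  ultimately obtain a where "a \<in> {z \<in> A. x \<le> z}" "\<And>b. a < b \<Longrightarrow> b \<notin> {z \<in> A. x \<le> z}"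
    unfolding wfp_def by (rule wfE_min) blast
  then have "a \<in> maximals A" "x \<le> a"
    by (auto simp: maximals_def order.order_iff_strict dest: order.strict_trans)
  then show thesis by (rule that)
qed

section \<open>Computation rules and the axioms other than adjointness\<close>

locale finite_height_complemented_poset =
  fixes c :: "'a::{order_bot,order_top} \<Rightarrow> 'a"
  assumes finite_height: "finite_height (UNIV :: 'a set)"
    and complementation: "complementation c"
    and involution: "\<And>x. c (c x) = x"
begin

lemma isLub_compl: "isLub UNIV {x, c x} top"
  using complementation by (simp add: complementation_def)

lemma isGlb_compl: "isGlb UNIV {x, c x} bot"
  using complementation by (simp add: complementation_def)

lemma compl_bot: "c bot = top"
  using isLub_compl[of bot] by (simp add: isLub_pair_of_le)

lemma compl_top: "c top = bot"
  using isGlb_compl[of top] by (simp add: isGlb_pair_of_le)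

text \<open>The right-hand side is a singleton or empty, so the equation holds whether or not the
  meet of \<open>u\<close> and \<open>y\<close> exists.\<close>

lemma odot_eq_meet:
  assumes "isLub UNIV {x, c y} u"
  shows "odot c x y = {z. isGlb UNIV {u, y} z}"
  by (simp add: odot_def set_meet_def minimals_upper_cone_of_isLub[OF assms])

lemma arrow_eq_join:
  assumes "isGlb UNIV {x, y} u"
  shows "arrow c x y = {z. isLub UNIV {c x, u} z}"
  by (simp add: arrow_def set_join_def maximals_lower_cone_of_isGlb[OF assms])

lemma arrow_bot: "arrow c x bot = {c x}"
  by (simp add: arrow_eq_join[of x bot bot] isGlb_pair_of_le isLub_pair_of_le)

lemma odot_idempotent: "odot c x x = {x}"
  by (simp add: odot_eq_meet[OF isLub_compl] isGlb_pair_of_le)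

lemma double_negation_arrow: "double_negation (arrow c)"
  by (simp add: double_negation_def set_op_def arrow_bot involution)

lemma odot_nonempty:
  assumes "odot_defined c x y"
  shows "odot c x y \<noteq> {}"
proof -
  \<comment> \<open>The bound \<open>top\<close> makes the cone non-empty, and finite height then
    yields a minimal element.\<close>
  have "top \<in> upper_cone x (c y)" by (simp add: upper_cone_def)
  then obtain a where "a \<in> minimals (upper_cone x (c y))"
    using finite_height_minimal_below[OF finite_height] by blast
  then show ?thesis
    using assms unfolding odot_defined_def set_meet_defined_def odot_def set_meet_def by blast
qed

lemma arrow_nonempty:
  assumes "arrow_defined c x y"
  shows "arrow c x y \<noteq> {}"
proof -
  have "bot \<in> lower_cone x y" by (simp add: lower_cone_def)
  then obtain a where "a \<in> maximals (lower_cone x y)"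
    using finite_height_maximal_above[OF finite_height] by blast
  then show ?thesis
    using assms unfolding arrow_defined_def set_join_defined_def arrow_def set_join_def by blast
qed

text \<open>In each axiom except non-emptiness, the cone involved has a least or greatest element,
  so its set of extremal elements collapses to a singleton.\<close>

lemma operator_residuated_base_odot_arrow:
  assumes odot: "\<And>x y. odot_defined c x y" and arrow: "\<And>x y. arrow_defined c x y"
  shows "operator_residuated_base (odot c) (arrow c)"
proof
  fix x y :: 'a
  show "odot c x y \<noteq> {}" by (rule odot_nonempty[OF odot])
  show "arrow c x y \<noteq> {}" by (rule arrow_nonempty[OF arrow])
  show "odot c x top = {x}"
    by (simp add: odot_eq_meet[of x top x] isLub_pair_of_le isGlb_pair_of_le compl_top)
  show "odot c top x = {x}"
    by (simp add: odot_eq_meet[of top x top] isLub_pair_of_le isGlb_pair_of_le)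
  show "set_meet_defined {x} {y} \<and> odot c x y = set_meet {x} {y}"
    if "\<forall>u\<in>arrow c y bot. u \<le> x"
  proof -
    \<comment> \<open>Since \<open>arrow c y bot\<close> is \<open>{c y}\<close>, the premise says
      \<open>c y \<le> x\<close>.\<close>
    have "isLub UNIV {x, c y} x"
      using that by (simp add: arrow_bot isLub_pair_of_le)
    from minimals_upper_cone_of_isLub[OF this] show ?thesis
      using odot[of x y] by (simp add: odot_defined_def odot_def)
  qed
  show "set_join_defined (arrow c x bot) {y} \<and> arrow c x y = set_join (arrow c x bot) {y}"
    if "y \<le> x"
  proof -
    have "isGlb UNIV {x, y} y"
      using that by (simp add: isGlb_pair_of_le)
    from maximals_lower_cone_of_isGlb[OF this] show ?thesis
      using arrow[of x y] by (simp add: arrow_defined_def arrow_def arrow_bot[unfolded arrow_def])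
  qed
qed

section \<open>Adjointness and divisibility from the orthomodular laws\<close>

text \<open>The law is applied to the pair \<open>c y \<le> a\<close>, where the involution turns
  \<open>c (c y)\<close> into \<open>y\<close>. This fits the members of
  \<open>upper_cone x (c y)\<close>.\<close>

lemma weakly_orthomodularE:
  assumes "weakly_orthomodular c" "c y \<le> a"
  obtains m where "isGlb UNIV {a, y} m" "isLub UNIV {c y, m} a"
  using assms unfolding weakly_orthomodular_def by (metis involution)

lemma dually_weakly_orthomodularE:
  assumes "dually_weakly_orthomodular c" "b \<le> x"
  obtains j where "isLub UNIV {c x, b} j" "isGlb UNIV {j, x} b"
  using assms unfolding dually_weakly_orthomodular_def by (metis insert_commute)

lemma odot_defined_of_weakly_orthomodular:
  assumes "weakly_orthomodular c"
  shows "odot_defined c x y"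
  using weakly_orthomodularE[OF assms]
  by (fastforce simp: odot_defined_def set_meet_defined_def minimals_def upper_cone_def)

lemma arrow_defined_of_dually_weakly_orthomodular:
  assumes "dually_weakly_orthomodular c"
  shows "arrow_defined c x y"
  using dually_weakly_orthomodularE[OF assms]
  by (fastforce simp: arrow_defined_def set_join_defined_def maximals_def lower_cone_def)

lemma weakly_orthomodular_adjoint:
  assumes wom: "weakly_orthomodular c" and arrow: "arrow_defined c y z"
    and "sqle (odot c x y) {z}"
  shows "sqle {x} (arrow c y z)"
proof -
  obtain a m where a: "x \<le> a" "c y \<le> a" and m: "isGlb UNIV {a, y} m" "m \<le> z"
    using assms(3) by (auto simp: sqle_def odot_def set_meet_def minimals_def upper_cone_def)
  \<comment> \<open>The meet supplied by the law is the given \<open>m\<close>, since meets are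
    unique.\<close>
  have lub: "isLub UNIV {c y, m} a"
    using weakly_orthomodularE[OF wom a(2)] isGlb_pair_unique[OF m(1)] by metis
  have "m \<in> lower_cone y z"
    using m by (simp add: lower_cone_def isGlb_pair_iff)
  then obtain b where b: "b \<in> maximals (lower_cone y z)" "m \<le> b"
    using finite_height_maximal_above[OF finite_height] by blast
  then obtain u where u: "isLub UNIV {c y, b} u"
    using arrow by (auto simp: arrow_defined_def set_join_defined_def)
  have "a \<le> u"
    using lub u b(2) by (auto simp: isLub_pair_iff intro: order.trans)
  moreover have "u \<in> arrow c y z"
    using u b(1) by (auto simp: arrow_def set_join_def)
  ultimately show ?thesis
    using a(1) by (auto simp: sqle_def intro: order.trans)
qed

lemma dually_weakly_orthomodular_adjoint:
  assumes dwom: "dually_weakly_orthomodular c" and odot: "odot_defined c x y"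
    and "sqle {x} (arrow c y z)"
  shows "sqle (odot c x y) {z}"
proof -
  obtain b u where b: "b \<le> y" "b \<le> z" and u: "isLub UNIV {c y, b} u" "x \<le> u"
    using assms(3) by (auto simp: sqle_def arrow_def set_join_def maximals_def lower_cone_def)
  have glb: "isGlb UNIV {u, y} b"
    using dually_weakly_orthomodularE[OF dwom b(1)] isLub_pair_unique[OF u(1)] by metis
  have "u \<in> upper_cone x (c y)"
    using u by (simp add: upper_cone_def isLub_pair_iff)
  then obtain a where a: "a \<in> minimals (upper_cone x (c y))" "a \<le> u"
    using finite_height_minimal_below[OF finite_height] by blast
  then obtain m where m: "isGlb UNIV {a, y} m"
    using odot by (auto simp: odot_defined_def set_meet_defined_def)
  \<comment> \<open>The element \<open>m\<close> lies below \<open>y\<close> and, through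
    \<open>a\<close>, below \<open>u\<close>; the meet of these two is \<open>b\<close>.\<close>
  have "m \<le> b"
    using glb m a(2) by (auto simp: isGlb_pair_iff intro: order.trans)
  moreover have "m \<in> odot c x y"
    using m a(1) by (auto simp: odot_def set_meet_def)
  ultimately show ?thesis
    using b(2) by (auto simp: sqle_def intro: order.trans)
qed

text \<open>Each maximal \<open>b\<close> of the lower cone contributes one element
  \<open>u\<close>, the join of \<open>c x\<close> and \<open>b\<close>, to
  \<open>arrow c x y\<close>, and \<open>odot c u x\<close> gives back exactly
  \<open>{b}\<close>.\<close>

lemma dually_weakly_orthomodular_divisible:
  assumes dwom: "dually_weakly_orthomodular c"
  shows "divisible (odot c) (arrow c)"
proof -
  have odot_join: "odot c u x = {b}" if "b \<le> x" "isLub UNIV {c x, b} u" for b u x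
  proof -
    have "isGlb UNIV {u, x} b"
      using dually_weakly_orthomodularE[OF dwom that(1)] isLub_pair_unique[OF that(2)] by metis
    \<comment> \<open>As \<open>u\<close> is already above \<open>c x\<close>, forming
      \<open>odot c u x\<close> only takes the meet of \<open>u\<close> with
      \<open>x\<close>.\<close>
    moreover have "isLub UNIV {u, c x} u"
      using that(2) by (simp add: isLub_pair_iff)
    ultimately show ?thesis
      by (auto simp: odot_eq_meet dest: isGlb_pair_unique)
  qed
  have "set_op (odot c) (arrow c x y) x = maximals (lower_cone x y)" for x y
  proof -
    have le: "b \<le> x" if "b \<in> maximals (lower_cone x y)" for b
      using that by (simp add: maximals_def lower_cone_def)
    show ?thesis
    proof (intro equalityI subsetI)
      fix z assume "z \<in> set_op (odot c) (arrow c x y) x"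
      then obtain b u where b: "b \<in> maximals (lower_cone x y)" "isLub UNIV {c x, b} u" "z \<in> odot c u x"
        by (auto simp: set_op_def arrow_def set_join_def)
      then show "z \<in> maximals (lower_cone x y)"
        using odot_join[OF le[OF b(1)] b(2)] by simp
    next
      fix b assume b: "b \<in> maximals (lower_cone x y)"
      then obtain u where u: "isLub UNIV {c x, b} u"
        using dually_weakly_orthomodularE[OF dwom le] by blast
      then have "b \<in> odot c u x" "u \<in> arrow c x y"
        using odot_join[OF le[OF b] u] b by (auto simp: arrow_def set_join_def)
      then show "b \<in> set_op (odot c) (arrow c x y) x"
        by (auto simp: set_op_def)
    qed
  qed
  then show ?thesis by (simp add: divisible_def)
qed

lemma set_join_arrow_bot:
  "set_join_defined {x} (arrow c x bot)" "set_join {x} (arrow c x bot) = {top}"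
  using isLub_compl[of x]
  by (auto simp: arrow_bot set_join_defined_def set_join_def dest: isLub_pair_unique)

end

theorem theorem13:
  fixes c :: "'a::{order_bot,order_top} \<Rightarrow> 'a"
  assumes "finite_height (UNIV :: 'a set)"
    and "complementation c"
    and "\<And>x. c (c x) = x"
  shows "c bot = top \<and> c top = bot \<and>
    (weakly_orthomodular c \<longrightarrow>
      (\<forall>x y. odot_defined c x y \<and> odot c x y \<noteq> {}) \<and>
      ((\<forall>x y. arrow_defined c x y) \<longrightarrow>
        operator_residuated_base (odot c) (arrow c) \<and>
        idempotent_dot (odot c) \<and>
        double_negation (arrow c) \<and>
        (\<forall>x. set_join_defined {x} (arrow c x bot) \<and> set_join {x} (arrow c x bot) = {top}) \<and>
        (\<forall>x. arrow c x bot = {c x}) \<and>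
        (\<forall>x y z. sqle (odot c x y) {z} \<longrightarrow> sqle {x} (arrow c y z)))) \<and>
    (dually_weakly_orthomodular c \<longrightarrow>
      (\<forall>x y. arrow_defined c x y \<and> arrow c x y \<noteq> {}) \<and>
      ((\<forall>x y. odot_defined c x y) \<longrightarrow>
        operator_residuated_base (odot c) (arrow c) \<and>
        idempotent_dot (odot c) \<and>
        divisible (odot c) (arrow c) \<and>
        double_negation (arrow c) \<and>
        (\<forall>x. arrow c x bot = {c x}) \<and>
        (\<forall>x y z. sqle {x} (arrow c y z) \<longrightarrow> sqle (odot c x y) {z})))"
proof -
  interpret finite_height_complemented_poset c
    using assms by unfold_locales
  show ?thesis
    using odot_defined_of_weakly_orthomodular arrow_defined_of_dually_weakly_orthomodular
    by (simp add: compl_bot compl_top arrow_bot odot_nonempty arrow_nonempty idempotent_dot_def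
        odot_idempotent double_negation_arrow operator_residuated_base_odot_arrow
        set_join_arrow_bot[unfolded arrow_bot] weakly_orthomodular_adjoint
        dually_weakly_orthomodular_adjoint dually_weakly_orthomodular_divisible)
qed

end
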